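(* Let $\mathcal{M}$ be a complete connected Riemannian manifold and let $f:\mathcal{M}\to\mathbb{R}$ be continuously differentiable. Assume that $\operatorname{grad} f$ is $L$-Lipschitz continuous on $\mathcal{M}$ ($L>0$) and that there is $f_*\in\mathbb{R}$ with $f(x)\ge f_*$ for all $x\in\mathcal{M}$. Let $\{x_n\}$ (together with $\{w_n\},\{\alpha_n\}$) be generated by the RIAG-R algorithm with parameters $\eta>0$, $\varepsilon>0$, $\mu\in(0,1)$ and initial points $x_0,x_1\in\mathcal{M}$, and suppose $\inf_n\alpha_n>0$. If $\{x_n\}$ is bounded in $\mathcal{M}$, then every cluster point $x^*$ of $\{x_n\}$ is a critical point of $f$, i.e. $\operatorname{grad} f(x^* )=0$.
   Context: Notation: $\langle\cdot,\cdot\rangle$ and $\lVert\cdot\rVert$ are the Riemannian inner product and norm on the relevant tangent space, $d$ is the Riemannian distance, $\exp_x:T_x\mathcal{M}\to\mathcal{M}$ is the exponential map, and $\log_x(y)\in T_x\mathcal{M}$ denotes the logarithmic map, satisfying $\exp_x(\log_x(y))=y$ and $\lVert\log_x(y)\rVert=d(x,y)$. $\operatorname{grad} f$ is the Riemannian gradient. $L$-Lipschitz gradient: for any $x,y\in\mathcal{M}$ joined by a minimising geodesic $\gamma:[0,1]\to\mathcal{M}$ from $x$ to $y$, $\lVert \mathcal{P}_{\gamma,0,1}\operatorname{grad} f(x)-\operatorname{grad} f(y)\rVert\le L\,d(x,y)$, where $\mathcal{P}_{\gamma,0,1}:T_x\mathcal{M}\to T_y\mathcal{M}$ is parallel transport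 along $\gamma$. RIAG-R algorithm (parameters $\eta>0$, $\varepsilon>0$, $\mu\in(0,1)$; initial points $x_0,x_1\in\mathcal{M}$): set $G_0=0$, and for $n=1,2,3,\dots$: (1) $\bar\mu_n=\min\{\mu,\ \mu\, d(x_n,x_{n-1})\}$ if $x_n\ne x_{n-1}$, and $\bar\mu_n=\mu$ otherwise; (2) $d_n=-\log_{x_n}(x_{n-1})\in T_{x_n}\mathcal{M}$; (3) $\tilde\mu_n=0$ if $\langle\operatorname{grad} f(x_n),d_n\rangle>0$, and $\tilde\mu_n=\bar\mu_n$ otherwise; (4) $w_n=\exp_{x_n}(\tilde\mu_n d_n)$; (5) $G_n=G_{n-1}+\lVert\operatorname{grad} f(w_n)\rVert^2$ and $\alpha_n=\eta/(\sqrt{G_n}+\varepsilon)$; (6) $x_{n+1}=\exp_{w_n}(-\alpha_n\operatorname{grad} f(w_n))$. The iteration is run indefinitely, producing infinite sequences. *)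

theory Defs
  imports "HOL-Analysis.Analysis"
begin

subsection \<open>Smooth maps between open subsets of Euclidean spaces\<close>

fun Ck_on :: "nat \<Rightarrow> 'a::real_normed_vector set \<Rightarrow> ('a \<Rightarrow> 'b::real_normed_vector) \<Rightarrow> bool" where
  "Ck_on 0 S f \<longleftrightarrow> continuous_on S f"
| "Ck_on (Suc k) S f \<longleftrightarrow>
     (\<forall>x\<in>S. f differentiable (at x)) \<and> (\<forall>v. Ck_on k S (\<lambda>x. frechet_derivative f (at x) v))"

definition smooth_on :: "'a::real_normed_vector set \<Rightarrow> ('a \<Rightarrow> 'b::real_normed_vector) \<Rightarrow> bool" where
  "smooth_on S f \<longleftrightarrow> (\<forall>k. Ck_on k S f)"

subsection \<open>Riemannian manifolds\<close>

text \<open>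
  The manifold is the whole type \<open>'m\<close>, modelled on the Euclidean space \<open>'e\<close>. A chart is a pair of
  a domain and a coordinate map; the coordinate map is meaningful on the domain only.

  A tangent vector at \<open>x\<close> is represented by its coordinates, an element of \<open>'e\<close>, with respect to
  \<open>base_chart M x\<close>, a chart around \<open>x\<close> selected once and for all. So every tangent space is a copy
  of \<open>'e\<close> as a vector space, its inner product is \<open>rmetric M x\<close> (not the inner product of \<open>'e\<close>),
  and the maps \<open>to_chart\<close> and \<open>of_chart\<close> convert between this representation and the coordinates
  in any other chart around \<open>x\<close>.
\<close>

type_synonym ('m, 'e) chart = "'m set \<times> ('m \<Rightarrow> 'e)"

record ('m, 'e) riem =
  atlas :: "('m, 'e) chart set"
  rmetric :: "'m \<Rightarrow> 'e \<Rightarrow> 'e \<Rightarrow> real"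

definition chart_inv :: "('m, 'e) chart \<Rightarrow> 'e \<Rightarrow> 'm" where
  "chart_inv c = inv_into (fst c) (snd c)"

definition base_chart :: "('m, 'e, 'z) riem_scheme \<Rightarrow> 'm \<Rightarrow> ('m, 'e) chart" where
  "base_chart M x = (SOME c. c \<in> atlas M \<and> x \<in> fst c)"

definition to_chart ::
  "('m, 'e::euclidean_space, 'z) riem_scheme \<Rightarrow> ('m, 'e) chart \<Rightarrow> 'm \<Rightarrow> 'e \<Rightarrow> 'e" where
  "to_chart M c x v =
     frechet_derivative (snd c \<circ> chart_inv (base_chart M x)) (at (snd (base_chart M x) x)) v"

definition of_chart ::
  "('m, 'e::euclidean_space, 'z) riem_scheme \<Rightarrow> ('m, 'e) chart \<Rightarrow> 'm \<Rightarrow> 'e \<Rightarrow> 'e" where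
  "of_chart M c x v =
     frechet_derivative (snd (base_chart M x) \<circ> chart_inv c) (at (snd c x)) v"

definition chart_metric ::
  "('m, 'e::euclidean_space, 'z) riem_scheme \<Rightarrow> ('m, 'e) chart \<Rightarrow> 'e \<Rightarrow> 'e \<Rightarrow> 'e \<Rightarrow> real" where
  "chart_metric M c y u v =
     (let p = chart_inv c y in rmetric M p (of_chart M c p u) (of_chart M c p v))"

definition smooth_manifold ::
  "('m::{second_countable_topology,t2_space}, 'e::euclidean_space, 'z) riem_scheme \<Rightarrow> bool" where
  "smooth_manifold M \<longleftrightarrow>
     \<Union> (fst ` atlas M) = UNIV \<and>
     (\<forall>c\<in>atlas M. open (fst c) \<and> open (snd c ` fst c) \<and>
        homeomorphism (fst c) (snd c ` fst c) (snd c) (chart_inv c)) \<and>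
     (\<forall>c\<in>atlas M. \<forall>c'\<in>atlas M. smooth_on (snd c ` (fst c \<inter> fst c')) (snd c' \<circ> chart_inv c))"

definition riemannian_manifold ::
  "('m::{second_countable_topology,t2_space}, 'e::euclidean_space, 'z) riem_scheme \<Rightarrow> bool" where
  "riemannian_manifold M \<longleftrightarrow>
     smooth_manifold M \<and>
     (\<forall>x. bilinear (rmetric M x) \<and>
        (\<forall>u v. rmetric M x u v = rmetric M x v u) \<and>
        (\<forall>u. u \<noteq> 0 \<longrightarrow> rmetric M x u u > 0)) \<and>
     (\<forall>c\<in>atlas M. \<forall>u v. smooth_on (snd c ` fst c) (\<lambda>y. chart_metric M c y u v))"

definition tnorm :: "('m, 'e, 'z) riem_scheme \<Rightarrow> 'm \<Rightarrow> 'e \<Rightarrow> real" where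
  "tnorm M x v = sqrt (rmetric M x v v)"

subsection \<open>Curves, length and distance\<close>

text \<open>
  Derivatives on an interval \<open>I\<close> are taken within \<open>I\<close>, hence are one-sided at end points that
  belong to \<open>I\<close>. Coordinate expressions along a curve matter only near those times at which the
  curve is in the domain of the chart, which is open.
\<close>

definition differentiable_curve ::
  "('m::topological_space, 'e::euclidean_space, 'z) riem_scheme \<Rightarrow> real set \<Rightarrow> (real \<Rightarrow> 'm) \<Rightarrow> bool" where
  "differentiable_curve M I \<gamma> \<longleftrightarrow>
     continuous_on I \<gamma> \<and>
     (\<forall>t\<in>I. \<forall>c\<in>atlas M. \<gamma> t \<in> fst c \<longrightarrow> (snd c \<circ> \<gamma>) differentiable (at t within I))"

definition velocity ::
  "('m, 'e::euclidean_space, 'z) riem_scheme \<Rightarrow> real set \<Rightarrow> (real \<Rightarrow> 'm) \<Rightarrow> real \<Rightarrow> 'e" where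
  "velocity M I \<gamma> t = vector_derivative (snd (base_chart M (\<gamma> t)) \<circ> \<gamma>) (at t within I)"

definition C1_curve ::
  "('m::topological_space, 'e::euclidean_space, 'z) riem_scheme \<Rightarrow> real set \<Rightarrow> (real \<Rightarrow> 'm) \<Rightarrow> bool" where
  "C1_curve M I \<gamma> \<longleftrightarrow>
     differentiable_curve M I \<gamma> \<and>
     (\<forall>t\<in>I. \<forall>c\<in>atlas M. \<gamma> t \<in> fst c \<longrightarrow>
        continuous (at t within I) (\<lambda>s. to_chart M c (\<gamma> s) (velocity M I \<gamma> s)))"

text \<open>
  The set \<open>S\<close> contains the break points: the curve is \<open>C\<^sup>1\<close>, up to the end points, on every compact
  subinterval that has no break point in its interior.
\<close>

definition piecewise_C1_curve ::
  "('m::topological_space, 'e::euclidean_space, 'z) riem_scheme \<Rightarrow> (real \<Rightarrow> 'm) \<Rightarrow> bool" where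
  "piecewise_C1_curve M \<gamma> \<longleftrightarrow>
     continuous_on {0..1} \<gamma> \<and>
     (\<exists>S. finite S \<and>
        (\<forall>a b. 0 \<le> a \<and> a < b \<and> b \<le> 1 \<and> {a<..<b} \<inter> S = {} \<longrightarrow> C1_curve M {a..b} \<gamma>))"

definition curve_length ::
  "('m, 'e::euclidean_space, 'z) riem_scheme \<Rightarrow> (real \<Rightarrow> 'm) \<Rightarrow> real" where
  "curve_length M \<gamma> = integral {0..1} (\<lambda>t. tnorm M (\<gamma> t) (velocity M {0..1} \<gamma> t))"

definition rdist ::
  "('m::topological_space, 'e::euclidean_space, 'z) riem_scheme \<Rightarrow> 'm \<Rightarrow> 'm \<Rightarrow> real" where
  "rdist M x y =
     Inf {curve_length M \<gamma> | \<gamma>. piecewise_C1_curve M \<gamma> \<and> \<gamma> 0 = x \<and> \<gamma> 1 = y}"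

definition rbounded ::
  "('m::topological_space, 'e::euclidean_space, 'z) riem_scheme \<Rightarrow> 'm set \<Rightarrow> bool" where
  "rbounded M S \<longleftrightarrow> (\<exists>p r. \<forall>x\<in>S. rdist M p x \<le> r)"

subsection \<open>Levi-Civita connection, geodesics and the exponential map\<close>

text \<open>
  The Christoffel symbols of the Levi-Civita connection in a chart, as a bilinear map depending on
  the base point \<open>y\<close> in coordinate space: \<open>\<Gamma>(u,v) = (\<Gamma>\<^sup>k\<^sub>i\<^sub>j u\<^sup>i v\<^sup>j)\<^sub>k\<close>, characterised by Koszul's
  formula for constant coordinate fields.
\<close>

definition christoffel ::
  "('m, 'e::euclidean_space, 'z) riem_scheme \<Rightarrow> ('m, 'e) chart \<Rightarrow> 'e \<Rightarrow> 'e \<Rightarrow> 'e \<Rightarrow> 'e" where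
  "christoffel M c y u v =
     (THE w. \<forall>z. chart_metric M c y w z =
        (frechet_derivative (\<lambda>p. chart_metric M c p v z) (at y) u
         + frechet_derivative (\<lambda>p. chart_metric M c p u z) (at y) v
         - frechet_derivative (\<lambda>p. chart_metric M c p u v) (at y) z) / 2)"

text \<open>\<open>V t\<close> is a tangent vector at \<open>\<gamma> t\<close>; the condition is \<open>V' + \<Gamma>(\<gamma>', V) = 0\<close> in every chart.\<close>

definition parallel_along ::
  "('m, 'e::euclidean_space, 'z) riem_scheme \<Rightarrow> real set \<Rightarrow> (real \<Rightarrow> 'm) \<Rightarrow> (real \<Rightarrow> 'e) \<Rightarrow> bool" where
  "parallel_along M I \<gamma> V \<longleftrightarrow>
     (\<forall>t\<in>I. \<forall>c\<in>atlas M. \<gamma> t \<in> fst c \<longrightarrow>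
        ((\<lambda>s. to_chart M c (\<gamma> s) (V s)) has_vector_derivative
          - christoffel M c (snd c (\<gamma> t))
              (to_chart M c (\<gamma> t) (velocity M I \<gamma> t)) (to_chart M c (\<gamma> t) (V t)))
        (at t within I))"

definition parallel_transport ::
  "('m, 'e::euclidean_space, 'z) riem_scheme \<Rightarrow> (real \<Rightarrow> 'm) \<Rightarrow> real \<Rightarrow> real \<Rightarrow> 'e \<Rightarrow> 'e" where
  "parallel_transport M \<gamma> a b v =
     (SOME w. \<exists>V. parallel_along M {a..b} \<gamma> V \<and> V a = v \<and> V b = w)"

definition geodesic_on ::
  "('m::topological_space, 'e::euclidean_space, 'z) riem_scheme \<Rightarrow> real set \<Rightarrow> (real \<Rightarrow> 'm) \<Rightarrow> bool" where
  "geodesic_on M I \<gamma> \<longleftrightarrow> differentiable_curve M I \<gamma> \<and> parallel_along M I \<gamma> (velocity M I \<gamma>)"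

definition minimising_geodesic ::
  "('m::topological_space, 'e::euclidean_space, 'z) riem_scheme \<Rightarrow> (real \<Rightarrow> 'm) \<Rightarrow> 'm \<Rightarrow> 'm \<Rightarrow> bool" where
  "minimising_geodesic M \<gamma> x y \<longleftrightarrow>
     geodesic_on M {0..1} \<gamma> \<and> \<gamma> 0 = x \<and> \<gamma> 1 = y \<and> curve_length M \<gamma> = rdist M x y"

text \<open>Geodesic completeness: every initial condition is that of a geodesic defined for all times.\<close>

definition complete_riemannian ::
  "('m::topological_space, 'e::euclidean_space, 'z) riem_scheme \<Rightarrow> bool" where
  "complete_riemannian M \<longleftrightarrow>
     (\<forall>x v. \<exists>\<gamma>. geodesic_on M UNIV \<gamma> \<and> \<gamma> 0 = x \<and> velocity M UNIV \<gamma> 0 = v)"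

definition riem_exp ::
  "('m::topological_space, 'e::euclidean_space, 'z) riem_scheme \<Rightarrow> 'm \<Rightarrow> 'e \<Rightarrow> 'm" where
  "riem_exp M x v =
     (SOME y. \<exists>\<gamma>. geodesic_on M UNIV \<gamma> \<and> \<gamma> 0 = x \<and> velocity M UNIV \<gamma> 0 = v \<and> \<gamma> 1 = y)"

text \<open>
  Beyond the cut locus the initial velocity of a minimising geodesic is not unique; a logarithmic
  map is any selection, \<open>lg x y\<close> being a tangent vector at \<open>x\<close>.
\<close>

definition log_map ::
  "('m::topological_space, 'e::euclidean_space, 'z) riem_scheme \<Rightarrow> ('m \<Rightarrow> 'm \<Rightarrow> 'e) \<Rightarrow> bool" where
  "log_map M lg \<longleftrightarrow>
     (\<forall>x y. riem_exp M x (lg x y) = y \<and> tnorm M x (lg x y) = rdist M x y)"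

subsection \<open>Functions and gradients\<close>

definition C1_function ::
  "('m, 'e::euclidean_space, 'z) riem_scheme \<Rightarrow> ('m \<Rightarrow> real) \<Rightarrow> bool" where
  "C1_function M f \<longleftrightarrow> (\<forall>c\<in>atlas M. Ck_on 1 (snd c ` fst c) (f \<circ> chart_inv c))"

definition grad ::
  "('m, 'e::euclidean_space, 'z) riem_scheme \<Rightarrow> ('m \<Rightarrow> real) \<Rightarrow> 'm \<Rightarrow> 'e" where
  "grad M f x =
     (THE v. \<forall>u. rmetric M x v u =
        frechet_derivative (f \<circ> chart_inv (base_chart M x)) (at (snd (base_chart M x) x)) u)"

definition lipschitz_gradient ::
  "('m::topological_space, 'e::euclidean_space, 'z) riem_scheme \<Rightarrow> ('m \<Rightarrow> real) \<Rightarrow> real \<Rightarrow> bool" where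
  "lipschitz_gradient M f L \<longleftrightarrow>
     (\<forall>x y \<gamma>. minimising_geodesic M \<gamma> x y \<longrightarrow>
        tnorm M y (parallel_transport M \<gamma> 0 1 (grad M f x) - grad M f y) \<le> L * rdist M x y)"

subsection \<open>The RIAG-R iteration\<close>

text \<open>The entries \<open>w 0\<close> and \<open>\<alpha> 0\<close> do not belong to the iteration and are unconstrained.\<close>

definition riag_r ::
  "('m::topological_space, 'e::euclidean_space, 'z) riem_scheme \<Rightarrow> ('m \<Rightarrow> real) \<Rightarrow> ('m \<Rightarrow> 'm \<Rightarrow> 'e) \<Rightarrow>
   real \<Rightarrow> real \<Rightarrow> real \<Rightarrow> (nat \<Rightarrow> 'm) \<Rightarrow> (nat \<Rightarrow> 'm) \<Rightarrow> (nat \<Rightarrow> real) \<Rightarrow> (nat \<Rightarrow> real) \<Rightarrow> bool" where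
  "riag_r M f lg \<eta> \<epsilon> \<mu> x w G \<alpha> \<longleftrightarrow>
     G 0 = 0 \<and>
     (\<forall>n\<ge>1.
        let mubar = (if x n \<noteq> x (n - 1) then min \<mu> (\<mu> * rdist M (x n) (x (n - 1))) else \<mu>);
            d = - lg (x n) (x (n - 1));
            mutil = (if rmetric M (x n) (grad M f (x n)) d > 0 then 0 else mubar)
        in w n = riem_exp M (x n) (mutil *\<^sub>R d) \<and>
           G n = G (n - 1) + (tnorm M (w n) (grad M f (w n)))\<^sup>2 \<and>
           \<alpha> n = \<eta> / (sqrt (G n) + \<epsilon>) \<and>
           x (n + 1) = riem_exp M (w n) (- \<alpha> n *\<^sub>R grad M f (w n)))"

definition seq_cluster_point :: "(nat \<Rightarrow> 'm::topological_space) \<Rightarrow> 'm \<Rightarrow> bool" where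
  "seq_cluster_point x p \<longleftrightarrow> (\<exists>r. strict_mono r \<and> (x \<circ> r) \<longlonglongrightarrow> p)"

end

theory Submission
  imports Defs
begin

text \<open>
  Two facts about the iteration carry the proof. If the step sizes stay above some \<open>a > 0\<close>, then the
  accumulated sums \<open>G n\<close> of squared gradient norms are bounded, so \<open>\<parallel>grad f(w\<^sub>n)\<parallel> \<rightarrow> 0\<close>
  (\<open>riag_r_gradients_tendsto_zero\<close>). Moreover \<open>\<alpha> n \<le> \<eta> / \<epsilon>\<close>, so the geodesic from \<open>w\<^sub>n\<close> to
  \<open>x\<^sub>n\<^sub>+\<^sub>1 = exp\<^bsub>w\<^sub>n\<^esub>(- \<alpha>\<^sub>n grad f(w\<^sub>n))\<close> has length tending to zero. Along a subsequence with
  \<open>x\<^sub>n\<^sub>+\<^sub>1 \<rightarrow> x\<^sup>*\<close> the points \<open>w\<^sub>n\<close> therefore also tend to \<open>x\<^sup>*\<close>, and \<open>grad f(x\<^sup>*) = 0\<close> by continuity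
  of the differential (\<open>grad_eq_zero_of_tendsto\<close>).

  The geometric part is that the starting points of short geodesics converge with their end points
  (\<open>tendsto_of_short_exp\<close>). Geodesics have constant speed, because the Levi-Civita connection is
  metric (\<open>geodesic_constant_speed\<close>). On a compact coordinate ball around the limit the
  metric dominates a multiple of the Euclidean one (\<open>inner_form_compact_lower_bound\<close>), so the
  coordinate speed there is at most a constant times the Riemannian speed. A geodesic that ends near
  the centre at time \<open>1\<close> and is short enough must have been in the ball since time \<open>0\<close>
  (\<open>short_geodesic_stays_in_chart\<close>), and its coordinate displacement is bounded by its length.
\<close>

section \<open>Inner products as bilinear forms\<close>

text \<open>
  The metric is available as a family of bilinear forms whose value is known to be smooth only for
  constant pairs of vectors. Expanding in the fixed orthonormal basis of \<open>'e\<close> reduces continuity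
  and differentiability in all arguments jointly to these.
\<close>

lemma bilinear_expand:
  fixes B :: "'e::euclidean_space \<Rightarrow> 'e \<Rightarrow> real"
  assumes "bilinear B"
  shows "B u v = (\<Sum>i\<in>Basis. \<Sum>j\<in>Basis. (u \<bullet> i) * (v \<bullet> j) * B i j)"
proof -
  have "B u v = B (\<Sum>i\<in>Basis. (u \<bullet> i) *\<^sub>R i) (\<Sum>j\<in>Basis. (v \<bullet> j) *\<^sub>R j)"
    by (simp add: euclidean_representation)
  also have "\<dots> = (\<Sum>i\<in>Basis. \<Sum>j\<in>Basis. B ((u \<bullet> i) *\<^sub>R i) ((v \<bullet> j) *\<^sub>R j))"
    by (simp add: bilinear_sum[OF assms] sum.cartesian_product)
  finally show ?thesis
    by (simp add: bilinear_lmul[OF assms] bilinear_rmul[OF assms] mult.assoc mult.left_commute)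
qed

definition inner_form :: "('e::euclidean_space \<Rightarrow> 'e \<Rightarrow> real) \<Rightarrow> bool" where
  "inner_form B \<longleftrightarrow> bilinear B \<and> (\<forall>u v. B u v = B v u) \<and> (\<forall>u. u \<noteq> 0 \<longrightarrow> B u u > 0)"

lemma inner_formD:
  assumes "inner_form B"
  shows "bilinear B" "B u v = B v u" "u \<noteq> 0 \<Longrightarrow> B u u > 0" "B u u \<ge> 0"
proof -
  show B: "bilinear B" and "B u v = B v u" and pos: "u \<noteq> 0 \<Longrightarrow> B u u > 0"
    using assms unfolding inner_form_def by auto
  show "B u u \<ge> 0"
    using pos bilinear_lzero[OF B] by (cases "u = 0") (auto intro: less_imp_le)
qed

lemma inner_form_Cauchy_Schwarz:
  assumes "inner_form B"
  shows "\<bar>B u v\<bar> \<le> sqrt (B u u) * sqrt (B v v)"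
proof (cases "v = 0")
  case True
  then show ?thesis using bilinear_rzero[OF inner_formD(1)[OF assms]] by simp
next
  case False
  note B = inner_formD(1)[OF assms]
  have pos: "B v v > 0" using inner_formD(3)[OF assms False] .
  define c where "c = B u v / B v v"
  have "0 \<le> B (u - c *\<^sub>R v) (u - c *\<^sub>R v)" by (rule inner_formD(4)[OF assms])
  also have "\<dots> = B u u - 2 * c * B u v + c\<^sup>2 * B v v"
    by (simp add: bilinear_lsub[OF B] bilinear_rsub[OF B] bilinear_lmul[OF B] bilinear_rmul[OF B]
        inner_formD(2)[OF assms, of v u] power2_eq_square algebra_simps)
  also have "\<dots> = B u u - (B u v)\<^sup>2 / B v v"
    using pos by (simp add: c_def power2_eq_square field_simps)
  finally have "(B u v)\<^sup>2 \<le> B u u * B v v" using pos by (simp add: field_simps)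
  then show ?thesis
    using real_sqrt_le_mono real_sqrt_mult real_sqrt_abs by metis
qed

text \<open>
  This is what gives meaning to the two descriptions by \<open>THE\<close>: the gradient and the Christoffel
  symbols are both the vector that represents a linear functional.
\<close>

lemma inner_form_Riesz:
  fixes \<phi> :: "'e::euclidean_space \<Rightarrow> real"
  assumes "inner_form B" and "linear \<phi>"
  shows "\<exists>!w. \<forall>z. B w z = \<phi> z"
proof -
  note B = inner_formD(1)[OF assms(1)]
  have lin: "linear (B w)" for w using B unfolding bilinear_def by blast
  have uniq: "w = w'" if "\<forall>b\<in>Basis. B w b = B w' b" for w w'
  proof (rule ccontr)
    assume "w \<noteq> w'"
    then have "B (w - w') (w - w') > 0" using inner_formD(3)[OF assms(1)] by simp
    moreover have "B w = B w'"
      by (rule linear_eq_stdbasis[OF lin lin]) (use that in auto)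
    ultimately show False by (simp add: bilinear_lsub[OF B])
  qed
  \<comment> \<open>\<open>\<Phi>\<close> is the matrix of \<open>B\<close>; definiteness makes it injective, hence onto in finite dimension.\<close>
  define \<Phi> where "\<Phi> w = (\<Sum>b\<in>Basis. B w b *\<^sub>R b)" for w
  have \<Phi>_inner: "\<Phi> w \<bullet> b = B w b" if "b \<in> Basis" for w b
    unfolding \<Phi>_def using that by (simp add: inner_sum_left_Basis)
  have "linear \<Phi>"
    by (rule linearI)
      (simp_all add: \<Phi>_def bilinear_ladd[OF B] bilinear_lmul[OF B] scaleR_left_distrib
        sum.distrib scaleR_sum_right)
  moreover have "inj \<Phi>"
  proof (rule injI)
    fix w w' assume "\<Phi> w = \<Phi> w'"
    then have "\<forall>b\<in>Basis. B w b = B w' b" using \<Phi>_inner by metis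
    then show "w = w'" by (rule uniq)
  qed
  ultimately have "surj \<Phi>" by (rule linear_injective_imp_surjective) simp
  then obtain w where w: "\<Phi> w = (\<Sum>b\<in>Basis. \<phi> b *\<^sub>R b)" by (metis surjD)
  have "B w b = \<phi> b" if "b \<in> Basis" for b
    using \<Phi>_inner[OF that, of w] that unfolding w by (simp add: inner_sum_left_Basis)
  then have "B w = \<phi>"
    by (intro linear_eq_stdbasis[OF lin assms(2)]) auto
  then show ?thesis by (intro ex1I[of _ w]) (auto intro: uniq)
qed

text \<open>
  By homogeneity it is enough to bound \<open>g y u u\<close> below on unit vectors, where a positive minimum is
  attained by compactness. The bound makes coordinate length comparable to Riemannian length
  near a point.
\<close>

lemma inner_form_compact_lower_bound:
  fixes g :: "'a::topological_space \<Rightarrow> 'e::euclidean_space \<Rightarrow> 'e \<Rightarrow> real"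
  assumes "compact K" and "\<And>y. y \<in> K \<Longrightarrow> inner_form (g y)"
    and "\<And>u v. continuous_on K (\<lambda>y. g y u v)"
  shows "\<exists>m>0. \<forall>y\<in>K. \<forall>u. m * (norm u)\<^sup>2 \<le> g y u u"
proof (cases "K = {}")
  case True
  then show ?thesis by (intro exI[of _ 1]) auto
next
  case False
  define h where "h p = (\<Sum>i\<in>Basis. \<Sum>j\<in>Basis. (snd p \<bullet> i) * (snd p \<bullet> j) * g (fst p) i j)" for p
  have h: "h (y, u) = g y u u" if "y \<in> K" for y u
    using bilinear_expand[OF inner_formD(1)[OF assms(2)[OF that]], of u u] by (simp add: h_def)
  have cont: "continuous_on (K \<times> sphere 0 1) h"
    unfolding h_def
    by (intro continuous_intros continuous_on_compose2[OF assms(3) continuous_on_fst]) auto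
  obtain b :: 'e where "b \<in> Basis" using nonempty_Basis by blast
  then have "K \<times> sphere (0::'e) 1 \<noteq> {}" using False by auto
  then obtain z where z: "z \<in> K \<times> sphere 0 1"
    and min: "\<And>p. p \<in> K \<times> sphere 0 1 \<Longrightarrow> h z \<le> h p"
    using continuous_attains_inf[OF compact_Times[OF assms(1) compact_sphere] _ cont] by blast
  obtain y0 u0 where z_eq: "z = (y0, u0)" by (cases z)
  then have "y0 \<in> K" "u0 \<noteq> 0" using z by auto
  then have pos: "h z > 0"
    using inner_formD(3)[OF assms(2)] unfolding z_eq by (simp add: h)
  have "h z * (norm u)\<^sup>2 \<le> g y u u" if y: "y \<in> K" for y u
  proof (cases "u = 0")
    case True
    then show ?thesis using bilinear_lzero[OF inner_formD(1)[OF assms(2)[OF y]]] by simp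
  next
    case False
    note B = inner_formD(1)[OF assms(2)[OF y]]
    have "h z \<le> h (y, u /\<^sub>R norm u)" using y False by (intro min) auto
    also have "\<dots> = g y u u / (norm u)\<^sup>2"
      by (simp add: h[OF y] bilinear_lmul[OF B] bilinear_rmul[OF B] power2_eq_square divide_inverse)
    finally show ?thesis using False by (simp add: pos_le_divide_eq)
  qed
  then show ?thesis using pos by blast
qed

text \<open>
  The product rule for \<open>g\<^sub>y(u,u)\<close>, used for the squared speed of a curve. The first term comes from the
  motion of the base point; expanding in the basis separates it from those of the moving vector.
\<close>

lemma bilinear_family_derivative:
  fixes g :: "'e::euclidean_space \<Rightarrow> 'e \<Rightarrow> 'e \<Rightarrow> real"
  assumes S: "open S" "y t \<in> S" and bil: "\<And>p. p \<in> S \<Longrightarrow> bilinear (g p)"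
    and diff: "\<And>a b. (\<lambda>p. g p a b) differentiable (at (y t))"
    and y: "(y has_vector_derivative y') (at t)"
    and u: "(u has_vector_derivative u') (at t)"
  shows "((\<lambda>s. g (y s) (u s) (u s)) has_real_derivative
     frechet_derivative (\<lambda>p. g p (u t) (u t)) (at (y t)) y' + g (y t) u' (u t) + g (y t) (u t) u')
     (at t)"
proof -
  define D where "D a b = frechet_derivative (\<lambda>p. g p a b) (at (y t)) y'" for a b
  have ui: "((\<lambda>s. u s \<bullet> i) has_real_derivative u' \<bullet> i) (at t)" for i
    unfolding has_real_derivative_iff_has_vector_derivative
    by (rule bounded_linear.has_vector_derivative[OF bounded_linear_inner_left u])
  have D: "((\<lambda>s. g (y s) a b) has_real_derivative D a b) (at t)" for a b
    using vector_derivative_diff_chain_within[OF y has_derivative_at_withinI]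
      frechet_derivative_works[THEN iffD1, OF diff, of a b]
    unfolding D_def has_real_derivative_iff_has_vector_derivative o_def by blast
  have frech: "D a a = (\<Sum>i\<in>Basis. \<Sum>j\<in>Basis. (a \<bullet> i) * (a \<bullet> j) * D i j)" for a
  proof -
    have "((\<lambda>p. \<Sum>i\<in>Basis. \<Sum>j\<in>Basis. (a \<bullet> i) * (a \<bullet> j) * g p i j) has_derivative
       (\<lambda>h. \<Sum>i\<in>Basis. \<Sum>j\<in>Basis. (a \<bullet> i) * (a \<bullet> j) *
         frechet_derivative (\<lambda>p. g p i j) (at (y t)) h)) (at (y t))"
      by (intro derivative_intros frechet_derivative_works[THEN iffD1, OF diff])
    then have "((\<lambda>p. g p a a) has_derivative
       (\<lambda>h. \<Sum>i\<in>Basis. \<Sum>j\<in>Basis. (a \<bullet> i) * (a \<bullet> j) *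
         frechet_derivative (\<lambda>p. g p i j) (at (y t)) h)) (at (y t))"
      by (rule has_derivative_transform_within_open[OF _ S]) (simp add: bilinear_expand[OF bil])
    from frechet_derivative_at[OF this, symmetric] show ?thesis unfolding D_def by simp
  qed
  have ev: "\<forall>\<^sub>F s in nhds t. y s \<in> S"
    using topological_tendstoD[OF _ S] has_vector_derivative_continuous[OF y]
    unfolding continuous_at tendsto_at_iff_tendsto_nhds by blast
  have "((\<lambda>s. \<Sum>i\<in>Basis. \<Sum>j\<in>Basis. (u s \<bullet> i) * (u s \<bullet> j) * g (y s) i j) has_real_derivative
     (\<Sum>i\<in>Basis. \<Sum>j\<in>Basis. ((u' \<bullet> i) * (u t \<bullet> j) + (u' \<bullet> j) * (u t \<bullet> i)) * g (y t) i j
        + D i j * ((u t \<bullet> i) * (u t \<bullet> j)))) (at t)"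
    by (intro DERIV_sum DERIV_mult ui D)
  also have "(\<Sum>i\<in>Basis. \<Sum>j\<in>Basis. ((u' \<bullet> i) * (u t \<bullet> j) + (u' \<bullet> j) * (u t \<bullet> i)) * g (y t) i j
        + D i j * ((u t \<bullet> i) * (u t \<bullet> j))) = D (u t) (u t) + g (y t) u' (u t) + g (y t) (u t) u'"
    unfolding frech bilinear_expand[OF bil[OF S(2)], of u' "u t"]
      bilinear_expand[OF bil[OF S(2)], of "u t" u'] sum.distrib[symmetric]
    by (intro sum.cong refl) (simp add: algebra_simps)
  finally show ?thesis unfolding D_def
    by (rule DERIV_cong_ev[THEN iffD1, rotated -1])
      (use ev in \<open>auto elim!: eventually_mono simp: bilinear_expand[OF bil]\<close>)
qed

lemma linear_frechet_derivative_bilinear_family: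
  fixes g :: "'e::euclidean_space \<Rightarrow> 'e \<Rightarrow> 'e \<Rightarrow> real"
  assumes S: "open S" "y \<in> S" and bil: "\<And>p. p \<in> S \<Longrightarrow> bilinear (g p)"
    and diff: "\<And>a b. (\<lambda>p. g p a b) differentiable (at y)"
  shows "linear (\<lambda>z. frechet_derivative (\<lambda>p. g p v z) (at y) u)"
proof (rule linearI)
  note D = frechet_derivative_works[THEN iffD1, OF diff]
  fix a b
  have "((\<lambda>p. g p v (a + b)) has_derivative
     (\<lambda>u. frechet_derivative (\<lambda>p. g p v a) (at y) u + frechet_derivative (\<lambda>p. g p v b) (at y) u)) (at y)"
    by (rule has_derivative_transform_within_open[OF has_derivative_add[OF D D] S])
      (simp add: bilinear_radd[OF bil])
  from frechet_derivative_at[OF this, symmetric]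
  show "frechet_derivative (\<lambda>p. g p v (a + b)) (at y) u =
      frechet_derivative (\<lambda>p. g p v a) (at y) u + frechet_derivative (\<lambda>p. g p v b) (at y) u"
    by simp
next
  note D = frechet_derivative_works[THEN iffD1, OF diff]
  fix r a
  have "((\<lambda>p. g p v (r *\<^sub>R a)) has_derivative
     (\<lambda>u. r *\<^sub>R frechet_derivative (\<lambda>p. g p v a) (at y) u)) (at y)"
    by (rule has_derivative_transform_within_open[OF has_derivative_scaleR_right[OF D] S])
      (simp add: bilinear_rmul[OF bil])
  from frechet_derivative_at[OF this, symmetric]
  show "frechet_derivative (\<lambda>p. g p v (r *\<^sub>R a)) (at y) u =
      r *\<^sub>R frechet_derivative (\<lambda>p. g p v a) (at y) u"
    by simp
qed

section \<open>Changes of coordinates\<close>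

text \<open>
  The conversions \<open>to_chart\<close> and \<open>of_chart\<close> are both derivatives of transition maps, one from the
  base chart and one to it. With a common name their algebra becomes the cocycle rule alone.
\<close>

definition transition_derivative :: "('m, 'e::euclidean_space) chart \<Rightarrow> ('m, 'e) chart \<Rightarrow> 'm \<Rightarrow> 'e \<Rightarrow> 'e" where
  "transition_derivative c c' x = frechet_derivative (snd c' \<circ> chart_inv c) (at (snd c x))"

lemma to_chart_eq_transition_derivative: "to_chart M c x = transition_derivative (base_chart M x) c x"
  by (simp add: fun_eq_iff to_chart_def transition_derivative_def)

lemma of_chart_eq_transition_derivative: "of_chart M c x = transition_derivative c (base_chart M x) x"
  by (simp add: fun_eq_iff of_chart_def transition_derivative_def)

context
  fixes M :: "('m::{second_countable_topology,t2_space}, 'e::euclidean_space, 'z) riem_scheme"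
  assumes M: "riemannian_manifold M"
begin

lemma smooth_manifold: "smooth_manifold M"
  using M unfolding riemannian_manifold_def by blast

lemma base_chart: "base_chart M x \<in> atlas M" "x \<in> fst (base_chart M x)"
proof -
  have "\<exists>c. c \<in> atlas M \<and> x \<in> fst c"
    using smooth_manifold unfolding smooth_manifold_def by blast
  from someI_ex[OF this] show "base_chart M x \<in> atlas M" "x \<in> fst (base_chart M x)"
    unfolding base_chart_def by auto
qed

lemma
  assumes "c \<in> atlas M"
  shows open_chart_domain: "open (fst c)"
    and open_chart_image: "open (snd c ` fst c)"
    and continuous_on_chart: "continuous_on (fst c) (snd c)"
    and continuous_on_chart_inv: "continuous_on (snd c ` fst c) (chart_inv c)"
    and chart_inv_chart: "\<And>x. x \<in> fst c \<Longrightarrow> chart_inv c (snd c x) = x"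
  using smooth_manifold assms unfolding smooth_manifold_def homeomorphism_def by blast+

lemma open_chart_preimage:
  assumes "c \<in> atlas M" and "open U"
  shows "open {x \<in> fst c. snd c x \<in> U}"
  using continuous_open_preimage[OF continuous_on_chart open_chart_domain assms(2)] assms(1)
  by (simp add: vimage_def Int_def)

lemma has_derivative_transition_map:
  assumes "c \<in> atlas M" "c' \<in> atlas M" "x \<in> fst c" "x \<in> fst c'"
  shows "((snd c' \<circ> chart_inv c) has_derivative transition_derivative c c' x) (at (snd c x))"
proof -
  have "Ck_on 1 (snd c ` (fst c \<inter> fst c')) (snd c' \<circ> chart_inv c)"
    using smooth_manifold assms unfolding smooth_manifold_def smooth_on_def by blast
  then show ?thesis
    using assms unfolding transition_derivative_def One_nat_def Ck_on.simps
    by (intro frechet_derivative_works[THEN iffD1]) blast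
qed

text \<open>
  The chain rule, with the base point given on the manifold. Taking another chart for \<open>F\<close> gives the
  cocycle rule, and taking a real function gives the transformation of its differential.
\<close>

lemma has_derivative_change_chart:
  assumes c: "c \<in> atlas M" "c' \<in> atlas M" "x \<in> fst c" "x \<in> fst c'"
    and F: "((F \<circ> chart_inv c') has_derivative F') (at (snd c' x))"
  shows "((F \<circ> chart_inv c) has_derivative (\<lambda>u. F' (transition_derivative c c' x u))) (at (snd c x))"
proof -
  let ?S = "snd c ` fst c \<inter> chart_inv c -` fst c'"
  have S: "open ?S" "snd c x \<in> ?S"
    using continuous_open_preimage[OF continuous_on_chart_inv open_chart_image open_chart_domain]
      c chart_inv_chart by auto
  have "((F \<circ> chart_inv c') \<circ> (snd c' \<circ> chart_inv c) has_derivative F' \<circ> transition_derivative c c' x)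
      (at (snd c x))"
    using diff_chain_at[OF has_derivative_transition_map[OF c]] F c by (simp add: chart_inv_chart)
  then have "((F \<circ> chart_inv c) has_derivative F' \<circ> transition_derivative c c' x) (at (snd c x))"
    by (rule has_derivative_transform_within_open[OF _ S]) (use c in \<open>auto simp: chart_inv_chart\<close>)
  then show ?thesis by (simp add: o_def)
qed

lemma transition_derivative_self:
  assumes "c \<in> atlas M" "x \<in> fst c"
  shows "transition_derivative c c x u = u"
proof -
  have "((snd c \<circ> chart_inv c) has_derivative (\<lambda>u. u)) (at (snd c x))"
    by (rule has_derivative_transform_within_open[OF has_derivative_ident open_chart_image[OF assms(1)]])
      (use assms in \<open>auto simp: chart_inv_chart\<close>)
  from frechet_derivative_at[OF this] show ?thesis unfolding transition_derivative_def by metis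
qed

lemma transition_derivative_cocycle:
  assumes c: "c \<in> atlas M" "c' \<in> atlas M" "c'' \<in> atlas M"
    and x: "x \<in> fst c" "x \<in> fst c'" "x \<in> fst c''"
  shows "transition_derivative c' c'' x (transition_derivative c c' x u) = transition_derivative c c'' x u"
proof -
  have "((snd c'' \<circ> chart_inv c) has_derivative
      (\<lambda>u. transition_derivative c' c'' x (transition_derivative c c' x u)))
      (at (snd c x))"
    by (intro has_derivative_change_chart has_derivative_transition_map c x)
  from frechet_derivative_at[OF this] show ?thesis unfolding transition_derivative_def by metis
qed

lemma of_chart_to_chart:
  assumes "c \<in> atlas M" "x \<in> fst c"
  shows "of_chart M c x (to_chart M c x v) = v"
  unfolding to_chart_eq_transition_derivative of_chart_eq_transition_derivative
  using assms by (simp add: transition_derivative_cocycle transition_derivative_self base_chart)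

lemma to_chart_of_chart:
  assumes "c \<in> atlas M" "x \<in> fst c"
  shows "to_chart M c x (of_chart M c x v) = v"
  unfolding to_chart_eq_transition_derivative of_chart_eq_transition_derivative
  using assms by (simp add: transition_derivative_cocycle transition_derivative_self base_chart)

lemma linear_transition_derivative:
  assumes "c \<in> atlas M" "c' \<in> atlas M" "x \<in> fst c" "x \<in> fst c'"
  shows "linear (transition_derivative c c' x)"
  using has_derivative_transition_map[OF assms] by (rule has_derivative_linear)

section \<open>The metric in coordinates\<close>

lemma inner_form_rmetric: "inner_form (rmetric M x)"
  using M unfolding riemannian_manifold_def inner_form_def by blast

lemma chart_metric_chart:
  assumes "c \<in> atlas M" "x \<in> fst c"
  shows "chart_metric M c (snd c x) u v = rmetric M x (of_chart M c x u) (of_chart M c x v)"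
  using assms by (simp add: chart_metric_def chart_inv_chart Let_def)

lemma inner_form_chart_metric:
  assumes c: "c \<in> atlas M" and "y \<in> snd c ` fst c"
  shows "inner_form (chart_metric M c y)"
proof -
  obtain x where x: "x \<in> fst c" "y = snd c x" using assms(2) by blast
  note g = inner_formD[OF inner_form_rmetric[of x]]
  have lin: "linear (of_chart M c x)"
    unfolding of_chart_eq_transition_derivative by (intro linear_transition_derivative c x base_chart)
  have "bilinear (chart_metric M c y)"
    unfolding bilinear_def x(2) chart_metric_chart[OF c x(1)]
    using lin by (auto intro!: linearI simp: linear_add linear_scale
        bilinear_ladd[OF g(1)] bilinear_radd[OF g(1)] bilinear_lmul[OF g(1)] bilinear_rmul[OF g(1)])
  moreover have "of_chart M c x u \<noteq> 0" if "u \<noteq> 0" for u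
    using that to_chart_of_chart[OF c x(1), of u] to_chart_of_chart[OF c x(1), of 0] linear_0[OF lin]
    by metis
  ultimately show ?thesis
    unfolding inner_form_def x(2) chart_metric_chart[OF c x(1)]
    using g(2,3) by blast
qed

lemma smooth_on_chart_metric:
  assumes "c \<in> atlas M"
  shows "smooth_on (snd c ` fst c) (\<lambda>y. chart_metric M c y u v)"
  using M assms unfolding riemannian_manifold_def by blast

lemma continuous_on_chart_metric:
  assumes "c \<in> atlas M"
  shows "continuous_on (snd c ` fst c) (\<lambda>y. chart_metric M c y u v)"
  using smooth_on_chart_metric[OF assms, of u v, unfolded smooth_on_def, rule_format, of 0] by simp

lemma differentiable_chart_metric:
  assumes "c \<in> atlas M" "y \<in> snd c ` fst c"
  shows "(\<lambda>y. chart_metric M c y u v) differentiable (at y)"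
  using smooth_on_chart_metric[OF assms(1), of u v, unfolded smooth_on_def, rule_format, of "Suc 0"]
    assms(2) by auto

text \<open>
  Koszul's formula with all three arguments equal: two of the three derivatives cancel. The
  conservation of speed rests on this case.
\<close>

lemma christoffel_diagonal:
  assumes c: "c \<in> atlas M" and y: "y \<in> snd c ` fst c"
  shows "chart_metric M c y (christoffel M c y u u) u =
    frechet_derivative (\<lambda>p. chart_metric M c p u u) (at y) u / 2"
proof -
  let ?K = "\<lambda>z. (frechet_derivative (\<lambda>p. chart_metric M c p u z) (at y) u
         + frechet_derivative (\<lambda>p. chart_metric M c p u z) (at y) u
         - frechet_derivative (\<lambda>p. chart_metric M c p u u) (at y) z) / 2"
  have 1: "linear (\<lambda>z. frechet_derivative (\<lambda>p. chart_metric M c p u z) (at y) u)"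
    by (rule linear_frechet_derivative_bilinear_family[OF open_chart_image[OF c] y])
      (simp_all add: inner_formD(1)[OF inner_form_chart_metric[OF c]]
        differentiable_chart_metric[OF c y])
  have 2: "linear (frechet_derivative (\<lambda>p. chart_metric M c p u u) (at y))"
    by (rule linear_frechet_derivative[OF differentiable_chart_metric[OF c y]])
  have "linear ?K"
    by (rule linearI)
      (simp_all add: linear_add[OF 1] linear_add[OF 2] linear_scale[OF 1] linear_scale[OF 2]
        field_simps)
  from theI'[OF inner_form_Riesz[OF inner_form_chart_metric[OF c y] this]]
  show ?thesis unfolding christoffel_def by simp
qed

section \<open>Geodesics have constant speed\<close>

lemma has_vector_derivative_chart_curve:
  assumes \<gamma>: "differentiable_curve M UNIV \<gamma>" and c: "c \<in> atlas M" "\<gamma> t \<in> fst c"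
  shows "((snd c \<circ> \<gamma>) has_vector_derivative to_chart M c (\<gamma> t) (velocity M UNIV \<gamma> t)) (at t)"
proof -
  let ?b = "base_chart M (\<gamma> t)"
  have "(snd ?b \<circ> \<gamma>) differentiable (at t)"
    using \<gamma> base_chart unfolding differentiable_curve_def by blast
  then have v: "((snd ?b \<circ> \<gamma>) has_vector_derivative velocity M UNIV \<gamma> t) (at t)"
    unfolding velocity_def by (simp add: vector_derivative_works)
  have b: "((snd c \<circ> chart_inv ?b) has_derivative to_chart M c (\<gamma> t)) (at ((snd ?b \<circ> \<gamma>) t))"
    unfolding to_chart_eq_transition_derivative o_apply[of "snd _" \<gamma>]
    by (rule has_derivative_transition_map[OF base_chart(1) c(1) base_chart(2) c(2)])
  have d: "(((snd c \<circ> chart_inv ?b) \<circ> (snd ?b \<circ> \<gamma>)) has_vector_derivative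
      to_chart M c (\<gamma> t) (velocity M UNIV \<gamma> t)) (at t)"
    by (rule vector_derivative_diff_chain_within[OF v has_derivative_at_withinI[OF b]])
  have "open (\<gamma> -` fst ?b)"
    using \<gamma> open_chart_domain[OF base_chart(1)] unfolding differentiable_curve_def
    by (simp add: open_vimage)
  then show ?thesis
    by (rule has_vector_derivative_transform_within_open[OF d])
      (use base_chart in \<open>auto simp: chart_inv_chart\<close>)
qed

lemma chart_metric_to_chart:
  assumes "c \<in> atlas M" "x \<in> fst c"
  shows "chart_metric M c (snd c x) (to_chart M c x u) (to_chart M c x v) = rmetric M x u v"
  using assms by (simp add: chart_metric_chart of_chart_to_chart)

text \<open>
  In a chart with coordinate velocity \<open>u\<close>, the derivative of \<open>g(u,u)\<close> along the curve is
  \<open>D\<^sub>u g(u,u) + 2 g(u',u)\<close>. The geodesic equation \<open>u' = - \<Gamma>(u,u)\<close> turns the second term into minus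
  the first. The computation is local, in a chart around the point at each time, and
  shows that the derivative of the speed vanishes on the whole line.
\<close>

lemma geodesic_constant_speed:
  assumes \<gamma>: "geodesic_on M UNIV \<gamma>"
  shows "tnorm M (\<gamma> s) (velocity M UNIV \<gamma> s) = tnorm M (\<gamma> t) (velocity M UNIV \<gamma> t)"
proof -
  let ?v = "velocity M UNIV \<gamma>"
  have "((\<lambda>s. rmetric M (\<gamma> s) (?v s) (?v s)) has_real_derivative 0) (at t)" for t
  proof -
    define c where "c = base_chart M (\<gamma> t)"
    define u where "u s = to_chart M c (\<gamma> s) (?v s)" for s
    have c: "c \<in> atlas M" "\<gamma> t \<in> fst c" unfolding c_def by (rule base_chart)+
    have curve: "differentiable_curve M UNIV \<gamma>" using \<gamma> unfolding geodesic_on_def by blast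
    define y where "y = snd c (\<gamma> t)"
    have y: "y \<in> snd c ` fst c" unfolding y_def using c(2) by blast
    note g = inner_formD[OF inner_form_chart_metric[OF c(1) y]]
    have y': "((snd c \<circ> \<gamma>) has_vector_derivative u t) (at t)"
      unfolding u_def by (rule has_vector_derivative_chart_curve[OF curve c])
    have u': "(u has_vector_derivative - christoffel M c y (u t) (u t)) (at t)"
      using \<gamma> c unfolding geodesic_on_def parallel_along_def u_def y_def by blast
    have "((\<lambda>s. chart_metric M c ((snd c \<circ> \<gamma>) s) (u s) (u s)) has_real_derivative
        frechet_derivative (\<lambda>p. chart_metric M c p (u t) (u t)) (at y) (u t)
        + chart_metric M c y (- christoffel M c y (u t) (u t)) (u t)
        + chart_metric M c y (u t) (- christoffel M c y (u t) (u t))) (at t)"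
      using bilinear_family_derivative[OF open_chart_image[OF c(1)], of "snd c \<circ> \<gamma>" t,
          OF _ inner_formD(1)[OF inner_form_chart_metric[OF c(1)]]
            differentiable_chart_metric[OF c(1)] y' u'] c(2) by (simp add: y_def)
    then have "((\<lambda>s. chart_metric M c ((snd c \<circ> \<gamma>) s) (u s) (u s)) has_real_derivative 0) (at t)"
      by (simp add: bilinear_lneg[OF g(1)] bilinear_rneg[OF g(1)] g(2)[of "u t" "christoffel M c y _ _"]
          christoffel_diagonal[OF c(1) y])
    then show ?thesis
      unfolding has_field_derivative_def
    proof (rule has_derivative_transform_within_open)
      show "open (\<gamma> -` fst c)"
        using curve open_chart_domain[OF c(1)] unfolding differentiable_curve_def
        by (simp add: open_vimage)
    qed (use c in \<open>auto simp: u_def chart_metric_to_chart\<close>)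
  qed
  then have "rmetric M (\<gamma> s) (?v s) (?v s) = rmetric M (\<gamma> t) (?v t) (?v t)"
    by (intro DERIV_isconst_all) blast
  then show ?thesis by (simp add: tnorm_def)
qed

section \<open>Short geodesics in a chart\<close>

lemma geodesic_chart_speed_le:
  assumes \<gamma>: "geodesic_on M UNIV \<gamma>" and c: "c \<in> atlas M" "\<gamma> t \<in> fst c"
    and m: "m > 0" "\<And>u. m * (norm u)\<^sup>2 \<le> chart_metric M c (snd c (\<gamma> t)) u u"
  shows "norm (to_chart M c (\<gamma> t) (velocity M UNIV \<gamma> t))
    \<le> tnorm M (\<gamma> 0) (velocity M UNIV \<gamma> 0) / sqrt m"
proof -
  let ?v = "velocity M UNIV \<gamma> t" and ?u = "to_chart M c (\<gamma> t) (velocity M UNIV \<gamma> t)"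
  have "m * (norm ?u)\<^sup>2 \<le> rmetric M (\<gamma> t) ?v ?v"
    using m(2)[of ?u] by (simp add: chart_metric_to_chart[OF c])
  then have "sqrt (m * (norm ?u)\<^sup>2) \<le> tnorm M (\<gamma> t) ?v"
    unfolding tnorm_def by (rule real_sqrt_le_mono)
  then show ?thesis
    using m(1) by (simp add: geodesic_constant_speed[OF \<gamma>, of t 0] real_sqrt_mult field_simps)
qed

text \<open>
  By constant speed \<open>V\<close> limits the coordinate displacement during the unit time interval, but only
  while the curve is in the ball, where the metric is bounded below. Since the curve ends at time \<open>1\<close> within
  distance less than \<open>R - V\<close> of the centre, following it backwards in time from there it can never
  reach the boundary. The argument runs backwards because the limit point used later is a
  limit of end points, while nothing is known in advance about the starting points.
\<close>

lemma short_geodesic_stays_in_chart: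
  assumes \<gamma>: "geodesic_on M UNIV \<gamma>" and c: "c \<in> atlas M" "\<gamma> 1 \<in> fst c"
    and ball: "cball q R \<subseteq> snd c ` fst c"
    and m: "m > 0" "\<And>y u. y \<in> cball q R \<Longrightarrow> m * (norm u)\<^sup>2 \<le> chart_metric M c y u u"
    and V: "V = tnorm M (\<gamma> 0) (velocity M UNIV \<gamma> 0) / sqrt m"
    and short: "dist q (snd c (\<gamma> 1)) + V < R"
  shows "\<gamma> 0 \<in> fst c \<and> dist (snd c (\<gamma> 0)) (snd c (\<gamma> 1)) \<le> V"
proof -
  let ?v = "velocity M UNIV \<gamma>"
  have curve: "differentiable_curve M UNIV \<gamma>" using \<gamma> unfolding geodesic_on_def by blast
  then have cont: "continuous_on UNIV \<gamma>" unfolding differentiable_curve_def by blast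
  define U where "U = {x \<in> fst c. snd c x \<in> ball q R}"
  have "open U" unfolding U_def by (rule open_chart_preimage[OF c(1) open_ball])
  have "V \<ge> 0"
    unfolding V tnorm_def using m(1) inner_formD(4)[OF inner_form_rmetric] by simp
  have close: "dist (snd c (\<gamma> s)) (snd c (\<gamma> 1)) \<le> V"
    if I: "convex I" "I \<subseteq> {0..1}" "s \<in> I" "1 \<in> I" and inU: "\<And>t. t \<in> I \<Longrightarrow> \<gamma> t \<in> U" for s I
  proof -
    have "norm ((snd c \<circ> \<gamma>) s - (snd c \<circ> \<gamma>) 1) \<le> V * norm (s - 1)"
    proof (rule differentiable_bound[OF I(1) _ _ I(3,4)])
      fix t assume t: "t \<in> I"
      have t_c: "\<gamma> t \<in> fst c" "snd c (\<gamma> t) \<in> cball q R" using inU[OF t] unfolding U_def by auto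
      show "((snd c \<circ> \<gamma>) has_derivative (\<lambda>h. h *\<^sub>R to_chart M c (\<gamma> t) (?v t))) (at t within I)"
        using has_vector_derivative_chart_curve[OF curve c(1) t_c(1)]
        unfolding has_vector_derivative_def by (rule has_derivative_at_withinI)
      have "norm (to_chart M c (\<gamma> t) (?v t)) \<le> V"
        unfolding V by (rule geodesic_chart_speed_le[OF \<gamma> c(1) t_c(1) m(1) m(2)[OF t_c(2)]])
      then show "onorm (\<lambda>h. h *\<^sub>R to_chart M c (\<gamma> t) (?v t)) \<le> V"
        by (intro onorm_le) (simp add: mult.commute[of V] mult_left_mono)
    qed
    moreover have "V * norm (s - 1) \<le> V" using I(2,3) \<open>V \<ge> 0\<close> by (intro mult_left_le) auto
    ultimately show ?thesis by (simp add: dist_norm)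
  qed
  have "\<gamma> t \<in> U" if "t \<in> {0..1}" for t
  proof (rule ccontr)
    assume "\<gamma> t \<notin> U"
    \<comment> \<open>\<open>s\<close> is the last time at which the curve is outside the open ball.\<close>
    define E where "E = {0..1} \<inter> \<gamma> -` (- U)"
    have "closed (\<gamma> -` (- U))"
      using continuous_closed_vimage[of "- U" \<gamma>] \<open>open U\<close> cont
      by (simp add: closed_def continuous_on_eq_continuous_at)
    then have "compact E" unfolding E_def by (rule compact_Int_closed[OF compact_Icc])
    moreover have "E \<noteq> {}" using that \<open>\<gamma> t \<notin> U\<close> unfolding E_def by auto
    ultimately have "\<exists>s\<in>E. \<forall>t\<in>E. t \<le> s" by (rule compact_attains_sup)
    then obtain s where s: "s \<in> E" "\<And>t. t \<in> E \<Longrightarrow> t \<le> s" by blast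
    have "\<gamma> 1 \<in> U" using \<open>V \<ge> 0\<close> c(2) short unfolding U_def by auto
    then have "s < 1" using s(1) unfolding E_def by (cases "s = 1") auto
    have after: "\<gamma> t \<in> U" if "t \<in> {s<..1}" for t
      using that s(1) s(2)[of t] unfolding E_def by fastforce
    \<comment> \<open>After \<open>s\<close> the curve is even in the closed ball of smaller radius \<open>R'\<close>. Its
       preimage \<open>K\<close> is compact, hence closed in the manifold, so it contains the limit at \<open>s\<close>,
       which contradicts the choice of \<open>s\<close>.\<close>
    define R' where "R' = dist q (snd c (\<gamma> 1)) + V"
    define K where "K = chart_inv c ` cball q R'"
    have sub: "cball q R' \<subseteq> cball q R" using short unfolding R'_def by auto
    have "compact K"
      unfolding K_def using continuous_on_chart_inv[OF c(1)] sub ball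
      by (intro compact_continuous_image compact_cball) (auto intro: continuous_on_subset)
    then have "closed K" by (rule compact_imp_closed)
    have "\<gamma> t \<in> K" if t: "t \<in> {s<..1}" for t
    proof -
      have "dist (snd c (\<gamma> t)) (snd c (\<gamma> 1)) \<le> V"
        using t s(1) after \<open>s < 1\<close> by (intro close[of "{s<..1}"]) (auto simp: E_def)
      then have "snd c (\<gamma> t) \<in> cball q R'"
        using dist_triangle[of q "snd c (\<gamma> t)" "snd c (\<gamma> 1)"]
        unfolding R'_def by (simp add: dist_commute)
      moreover have "chart_inv c (snd c (\<gamma> t)) = \<gamma> t"
        using after[OF t] chart_inv_chart[OF c(1)] unfolding U_def by blast
      ultimately show ?thesis unfolding K_def by (metis imageI)
    qed
    then have "\<forall>\<^sub>F t in at_right s. \<gamma> t \<in> K"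
      using \<open>s < 1\<close> unfolding eventually_at_right_field by (intro exI[of _ 1]) auto
    moreover have "(\<gamma> \<longlongrightarrow> \<gamma> s) (at_right s)"
      using cont by (auto simp: continuous_on_def intro: tendsto_within_subset)
    ultimately have "\<gamma> s \<in> K"
      using \<open>closed K\<close> by (intro Lim_in_closed_set[of K \<gamma> "at_right s"]) auto
    moreover have "K \<subseteq> U"
    proof
      fix x assume "x \<in> K"
      then obtain y where y: "y \<in> cball q R'" "x = chart_inv c y" unfolding K_def by blast
      then obtain z where z: "z \<in> fst c" "y = snd c z" using sub ball by blast
      then have "x = z" using y chart_inv_chart[OF c(1)] by simp
      then show "x \<in> U" using y z short unfolding U_def R'_def by auto
    qed
    ultimately show False using s(1) unfolding E_def by blast
  qed
  then show ?thesis
    using close[of "{0..1}" 0] unfolding U_def by auto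
qed

text \<open>
  The choice in \<open>riem_exp\<close> is made among end points of geodesics with the given initial data, and
  completeness says that there is one; so the chosen point is itself the end of such a geodesic.
\<close>

lemma riem_exp_geodesic:
  assumes "complete_riemannian M"
  obtains \<gamma> where "geodesic_on M UNIV \<gamma>" "\<gamma> 0 = x" "velocity M UNIV \<gamma> 0 = v" "\<gamma> 1 = riem_exp M x v"
proof -
  have "\<exists>y \<gamma>. geodesic_on M UNIV \<gamma> \<and> \<gamma> 0 = x \<and> velocity M UNIV \<gamma> 0 = v \<and> \<gamma> 1 = y"
    using assms unfolding complete_riemannian_def by blast
  from someI_ex[OF this] show ?thesis
    using that unfolding riem_exp_def by blast
qed

text \<open>
  In a compact coordinate ball around \<open>p\<close> the metric is bounded below. Eventually the end points are
  near the centre and the lengths small compared with the radius, so the segments lie in the ball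
  and their coordinate displacement is at most \<open>V n\<close>, a fixed multiple of the length.
\<close>

lemma tendsto_of_short_exp:
  assumes complete: "complete_riemannian M"
    and lim: "(\<lambda>n. riem_exp M (w n) (v n)) \<longlonglongrightarrow> p"
    and short: "(\<lambda>n. tnorm M (w n) (v n)) \<longlonglongrightarrow> 0"
  shows "w \<longlonglongrightarrow> p"
proof -
  define c where "c = base_chart M p"
  have c: "c \<in> atlas M" "p \<in> fst c" unfolding c_def by (rule base_chart)+
  define q where "q = snd c p"
  define y where "y n = riem_exp M (w n) (v n)" for n
  have "q \<in> snd c ` fst c" using c(2) unfolding q_def by blast
  then obtain R where R: "R > 0" "cball q R \<subseteq> snd c ` fst c"
    using open_contains_cball open_chart_image[OF c(1)] by blast
  obtain m where m: "m > 0" "\<And>y u. y \<in> cball q R \<Longrightarrow> m * (norm u)\<^sup>2 \<le> chart_metric M c y u u"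
    using inner_form_compact_lower_bound[OF compact_cball[of q R], of "chart_metric M c"]
      inner_form_chart_metric[OF c(1)]
      continuous_on_subset[OF continuous_on_chart_metric[OF c(1)] R(2)] R(2) by blast
  define V where "V n = tnorm M (w n) (v n) / sqrt m" for n
  have V: "V \<longlonglongrightarrow> 0" unfolding V_def using tendsto_divide[OF short tendsto_const[of "sqrt m"]] m(1) by simp
  have ev_c: "\<forall>\<^sub>F n in sequentially. y n \<in> fst c"
    using topological_tendstoD[OF lim open_chart_domain[OF c(1)] c(2)] unfolding y_def .
  have cont: "isCont (snd c) p"
    using continuous_on_chart[OF c(1)] open_chart_domain[OF c(1)] c(2)
    by (simp add: continuous_on_eq_continuous_at)
  have yq: "(\<lambda>n. snd c (y n)) \<longlonglongrightarrow> q"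
    unfolding q_def y_def by (rule isCont_tendsto_compose[OF cont lim])
  have "(\<lambda>n. dist q (snd c (y n)) + V n) \<longlonglongrightarrow> dist q q + 0"
    by (intro tendsto_intros yq V)
  then have "\<forall>\<^sub>F n in sequentially. dist q (snd c (y n)) + V n < R"
    using R(1) by (intro order_tendstoD) auto
  with ev_c have *: "\<forall>\<^sub>F n in sequentially. w n \<in> fst c \<and> dist (snd c (w n)) (snd c (y n)) \<le> V n"
  proof eventually_elim
    case (elim n)
    obtain \<gamma> where \<gamma>: "geodesic_on M UNIV \<gamma>" "\<gamma> 0 = w n" "velocity M UNIV \<gamma> 0 = v n" "\<gamma> 1 = y n"
      unfolding y_def by (rule riem_exp_geodesic[OF complete])
    show ?case
      using short_geodesic_stays_in_chart[OF \<gamma>(1) c(1) _ R(2) m, of "V n"] elim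
      by (simp add: \<gamma> V_def)
  qed
  have "(\<lambda>n. dist (snd c (w n)) (snd c (y n))) \<longlonglongrightarrow> 0"
    by (rule tendsto_sandwich[OF _ _ tendsto_const V]) (use * in \<open>auto elim: eventually_mono\<close>)
  then have "(\<lambda>n. snd c (w n)) \<longlonglongrightarrow> q"
    by (intro Lim_transform[OF yq]) (simp add: dist_norm tendsto_norm_zero_iff)
  moreover have "isCont (chart_inv c) q"
    using continuous_on_chart_inv[OF c(1)] open_chart_image[OF c(1)] \<open>q \<in> snd c ` fst c\<close>
    using continuous_on_eq_continuous_at by blast
  ultimately have "(\<lambda>n. chart_inv c (snd c (w n))) \<longlonglongrightarrow> chart_inv c q"
    by (rule isCont_tendsto_compose[rotated])
  moreover have "chart_inv c q = p" unfolding q_def by (rule chart_inv_chart[OF c])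
  moreover have "\<forall>\<^sub>F n in sequentially. chart_inv c (snd c (w n)) = w n"
    using * by eventually_elim (simp add: chart_inv_chart[OF c(1)])
  ultimately show ?thesis by (simp add: tendsto_cong)
qed

section \<open>Gradients tending to zero\<close>

lemma
  assumes "C1_function M f" "c \<in> atlas M"
  shows differentiable_in_chart:
      "y \<in> snd c ` fst c \<Longrightarrow> (f \<circ> chart_inv c) differentiable (at y)"
    and continuous_on_derivative_in_chart:
      "continuous_on (snd c ` fst c) (\<lambda>y. frechet_derivative (f \<circ> chart_inv c) (at y) u)"
  using assms unfolding C1_function_def by auto

text \<open>
  The gradient is defined in the base chart, which may jump from point to point. Near a limit point
  its defining property has to be read in one fixed chart.
\<close>

lemma rmetric_grad:
  assumes f: "C1_function M f" and c: "c \<in> atlas M" "x \<in> fst c"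
  shows "rmetric M x (grad M f x) (of_chart M c x u) =
    frechet_derivative (f \<circ> chart_inv c) (at (snd c x)) u"
proof -
  let ?b = "base_chart M x"
  let ?D = "frechet_derivative (f \<circ> chart_inv ?b) (at (snd ?b x))"
  have diff: "(f \<circ> chart_inv ?b) differentiable (at (snd ?b x))"
    by (intro differentiable_in_chart[OF f] base_chart imageI)
  have "rmetric M x (grad M f x) v = ?D v" for v
    using theI'[OF inner_form_Riesz[OF inner_form_rmetric linear_frechet_derivative[OF diff]]]
    unfolding grad_def by blast
  moreover have "((f \<circ> chart_inv c) has_derivative (\<lambda>u. ?D (transition_derivative c ?b x u))) (at (snd c x))"
    by (intro has_derivative_change_chart c base_chart frechet_derivative_works[THEN iffD1] diff)
  from frechet_derivative_at[OF this, symmetric]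
  have "frechet_derivative (f \<circ> chart_inv c) (at (snd c x)) u = ?D (of_chart M c x u)"
    by (simp add: of_chart_eq_transition_derivative)
  ultimately show ?thesis by simp
qed

text \<open>
  The coordinates of the gradient need not depend continuously on the point, since the base chart
  varies. The differential in a chart around the limit does; by the Cauchy--Schwarz inequality it is
  small where the norm of the gradient is small.
\<close>

lemma grad_eq_zero_of_tendsto:
  assumes f: "C1_function M f" and w: "w \<longlonglongrightarrow> p"
    and small: "(\<lambda>n. tnorm M (w n) (grad M f (w n))) \<longlonglongrightarrow> 0"
  shows "grad M f p = 0"
proof -
  define c where "c = base_chart M p"
  have c: "c \<in> atlas M" "p \<in> fst c" unfolding c_def by (rule base_chart)+
  let ?D = "\<lambda>y. frechet_derivative (f \<circ> chart_inv c) (at y)"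
  have "isCont (snd c) p"
    using continuous_on_chart[OF c(1)] open_chart_domain[OF c(1)] c(2)
    by (simp add: continuous_on_eq_continuous_at)
  then have q: "(\<lambda>n. snd c (w n)) \<longlonglongrightarrow> snd c p" by (rule isCont_tendsto_compose[OF _ w])
  have lim: "(\<lambda>n. h (snd c (w n))) \<longlonglongrightarrow> h (snd c p)"
    if "continuous_on (snd c ` fst c) h" for h :: "'e \<Rightarrow> real"
    using that open_chart_image[OF c(1)] c(2)
    by (intro isCont_tendsto_compose[OF _ q]) (simp add: continuous_on_eq_continuous_at)
  have zero: "?D (snd c p) u = 0" for u
  proof -
    have ev: "\<forall>\<^sub>F n in sequentially. norm (?D (snd c (w n)) u)
        \<le> tnorm M (w n) (grad M f (w n)) * sqrt (chart_metric M c (snd c (w n)) u u)"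
      using topological_tendstoD[OF w open_chart_domain[OF c(1)] c(2)]
    proof eventually_elim
      case (elim n)
      show ?case
        using inner_form_Cauchy_Schwarz[OF inner_form_rmetric, of "w n" "grad M f (w n)" "of_chart M c (w n) u"]
        by (simp add: rmetric_grad[OF f c(1) elim] chart_metric_chart[OF c(1) elim] tnorm_def)
    qed
    have "(\<lambda>n. tnorm M (w n) (grad M f (w n)) * sqrt (chart_metric M c (snd c (w n)) u u))
        \<longlonglongrightarrow> 0 * sqrt (chart_metric M c (snd c p) u u)"
      by (intro tendsto_intros small lim continuous_on_chart_metric[OF c(1)])
    then have "(\<lambda>n. ?D (snd c (w n)) u) \<longlonglongrightarrow> 0"
      by (intro Lim_null_comparison[OF ev]) simp
    then show ?thesis
      by (rule LIMSEQ_unique[OF lim[OF continuous_on_derivative_in_chart[OF f c(1)]]])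
  qed
  have "rmetric M p (grad M f p) (grad M f p) = 0"
    using rmetric_grad[OF f c, of "to_chart M c p (grad M f p)"]
    by (simp add: zero of_chart_to_chart[OF c])
  then show ?thesis
    using inner_formD(3)[OF inner_form_rmetric, of "grad M f p" p] by force
qed

end

section \<open>The iteration\<close>

text \<open>
  A positive lower bound \<open>a\<close> for the step sizes means \<open>sqrt (G n) \<le> \<eta> / a\<close>. So the series of squared
  gradient norms, whose partial sums are the \<open>G n\<close>, converges and its terms tend to zero.
\<close>

lemma riag_r_gradients_tendsto_zero:
  assumes riag: "riag_r M f lg \<eta> \<epsilon> \<mu> x w G \<alpha>" and M: "riemannian_manifold M"
    and "\<eta> > 0" "\<epsilon> > 0" and inf: "(INF n\<in>{1..}. \<alpha> n) > 0"
  shows "(\<lambda>n. tnorm M (w n) (grad M f (w n))) \<longlonglongrightarrow> 0"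
    and "\<And>n. n \<ge> 1 \<Longrightarrow> 0 < \<alpha> n \<and> \<alpha> n \<le> \<eta> / \<epsilon>"
proof -
  define g where "g n = (tnorm M (w n) (grad M f (w n)))\<^sup>2" for n
  have G0: "G 0 = 0" and G_Suc: "G (Suc n) = G n + g (Suc n)"
    and \<alpha>: "n \<ge> 1 \<Longrightarrow> \<alpha> n = \<eta> / (sqrt (G n) + \<epsilon>)" for n
    using riag unfolding riag_r_def g_def Let_def by auto
  have G_sum: "G n = (\<Sum>k<n. g (Suc k))" for n
    by (induction n) (simp_all add: G0 G_Suc)
  then have G_nonneg: "G n \<ge> 0" for n by (simp add: sum_nonneg g_def)
  show \<alpha>_bounds: "0 < \<alpha> n \<and> \<alpha> n \<le> \<eta> / \<epsilon>" if "n \<ge> 1" for n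
    unfolding \<alpha>[OF that] using G_nonneg[of n] assms(3,4)
    by (auto intro!: divide_pos_pos divide_left_mono mult_pos_pos add_nonneg_pos)
  define a where "a = (INF n\<in>{1..}. \<alpha> n)"
  have "a > 0" using inf unfolding a_def .
  have a_le: "a \<le> \<alpha> n" if "n \<ge> 1" for n
    unfolding a_def using that \<alpha>_bounds by (intro cINF_lower bdd_belowI2[of _ 0]) (auto intro: less_imp_le)
  have G_le: "G n \<le> (\<eta> / a)\<^sup>2" for n
  proof (cases "n = 0")
    case False
    have "a * (sqrt (G n) + \<epsilon>) \<le> \<eta>"
      using a_le[of n] \<alpha>[of n] False G_nonneg[of n] \<open>\<epsilon> > 0\<close>
      by (simp add: pos_le_divide_eq add_nonneg_pos)
    then have "sqrt (G n) + \<epsilon> \<le> \<eta> / a" using \<open>a > 0\<close> by (simp add: field_simps)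
    then have "sqrt (G n) \<le> \<eta> / a" using \<open>\<epsilon> > 0\<close> by linarith
    then have "(sqrt (G n))\<^sup>2 \<le> (\<eta> / a)\<^sup>2" using G_nonneg by (intro power_mono) auto
    then show ?thesis using G_nonneg by simp
  qed (simp add: G0)
  have "summable (\<lambda>n. g (Suc n))"
    by (rule bounded_imp_summable[of _ "(\<eta> / a)\<^sup>2"])
      (use G_le[of "Suc _", unfolded G_sum] in \<open>auto simp: g_def lessThan_Suc_atMost\<close>)
  then have "g \<longlonglongrightarrow> 0" by (rule LIMSEQ_imp_Suc[OF summable_LIMSEQ_zero])
  then have "(\<lambda>n. sqrt (g n)) \<longlonglongrightarrow> sqrt 0" by (rule tendsto_real_sqrt)
  then have "(\<lambda>n. \<bar>tnorm M (w n) (grad M f (w n))\<bar>) \<longlonglongrightarrow> 0" by (simp add: g_def)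
  then show "(\<lambda>n. tnorm M (w n) (grad M f (w n))) \<longlonglongrightarrow> 0" by (rule tendsto_rabs_zero_cancel)
qed

theorem theorem3p6:
  fixes M :: "('m::{second_countable_topology,t2_space}, 'e::euclidean_space) riem"
    and f :: "'m \<Rightarrow> real" and lg :: "'m \<Rightarrow> 'm \<Rightarrow> 'e"
    and L fstar \<eta> \<epsilon> \<mu> :: real
    and x w :: "nat \<Rightarrow> 'm" and G \<alpha> :: "nat \<Rightarrow> real" and xstar :: 'm
  assumes "riemannian_manifold M" and "complete_riemannian M" and "connected (UNIV :: 'm set)"
    and "log_map M lg"
    and "C1_function M f"
    and "L > 0" and "lipschitz_gradient M f L"
    and "\<And>p. f p \<ge> fstar"
    and "\<eta> > 0" and "\<epsilon> > 0" and "0 < \<mu>" and "\<mu> < 1"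
    and "riag_r M f lg \<eta> \<epsilon> \<mu> x w G \<alpha>"
    and "(INF n\<in>{1..}. \<alpha> n) > 0"
    and "rbounded M (range x)"
    and "seq_cluster_point x xstar"
  shows "grad M f xstar = 0"
proof -
  note M = assms(1)
  obtain r where r: "strict_mono r" "(x \<circ> r) \<longlonglongrightarrow> xstar"
    using assms(16) unfolding seq_cluster_point_def by blast
  \<comment> \<open>\<open>x (k n + 1)\<close> is an entry of the convergent subsequence; the shift by \<open>2\<close>
      ensures \<open>k n \<ge> 1\<close>, as the update rule requires.\<close>
  define k where "k n = r (n + 2) - 1" for n
  have r_ge: "r (n + 2) \<ge> n + 2" for n by (rule strict_mono_imp_increasing[OF r(1)])
  then have k_ge: "k n \<ge> n + 1" for n unfolding k_def using r_ge[of n] by linarith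
  then have k_lim: "filterlim k at_top at_top"
    by (intro filterlim_at_top_mono[OF filterlim_ident]) (auto intro!: always_eventually simp: Suc_leD)
  note small = riag_r_gradients_tendsto_zero[OF assms(13) M assms(9,10,14)]
  define v where "v n = - \<alpha> (k n) *\<^sub>R grad M f (w (k n))" for n
  have grad_lim: "(\<lambda>n. tnorm M (w (k n)) (grad M f (w (k n)))) \<longlonglongrightarrow> 0"
    by (rule filterlim_compose[OF small(1) k_lim])
  have step: "riem_exp M (w (k n)) (v n) = (x \<circ> r) (n + 2)" for n
  proof -
    have "x (k n + 1) = riem_exp M (w (k n)) (v n)"
      using assms(13) k_ge[of n] unfolding riag_r_def Let_def v_def by simp
    moreover have "k n + 1 = r (n + 2)" using r_ge[of n] unfolding k_def by simp
    ultimately show ?thesis by simp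
  qed
  have tnorm_v: "tnorm M (w (k n)) (v n) = \<alpha> (k n) * tnorm M (w (k n)) (grad M f (w (k n)))" for n
  proof -
    note B = inner_formD(1)[OF inner_form_rmetric[OF M, of "w (k n)"]]
    have "\<alpha> (k n) > 0" using small(2) k_ge[of n] by simp
    then show ?thesis
      by (simp add: tnorm_def v_def bilinear_lmul[OF B] bilinear_rmul[OF B] bilinear_lneg[OF B]
          bilinear_rneg[OF B] real_sqrt_mult flip: mult.assoc)
  qed
  have short: "(\<lambda>n. tnorm M (w (k n)) (v n)) \<longlonglongrightarrow> 0"
  proof (rule Lim_null_comparison)
    have "\<bar>\<alpha> (k n)\<bar> \<le> \<eta> / \<epsilon>" for n
      using small(2)[of "k n"] k_ge[of n] by simp
    then show "\<forall>\<^sub>F n in sequentially.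
        norm (tnorm M (w (k n)) (v n)) \<le> \<eta> / \<epsilon> * \<bar>tnorm M (w (k n)) (grad M f (w (k n)))\<bar>"
      unfolding tnorm_v real_norm_def abs_mult by (intro always_eventually allI mult_right_mono) auto
    show "(\<lambda>n. \<eta> / \<epsilon> * \<bar>tnorm M (w (k n)) (grad M f (w (k n)))\<bar>) \<longlonglongrightarrow> 0"
      using tendsto_mult_right_zero[OF tendsto_rabs_zero[OF grad_lim]] .
  qed
  have "(\<lambda>n. riem_exp M (w (k n)) (v n)) \<longlonglongrightarrow> xstar"
    unfolding step by (rule LIMSEQ_ignore_initial_segment[OF r(2)])
  then have "(\<lambda>n. w (k n)) \<longlonglongrightarrow> xstar"
    by (rule tendsto_of_short_exp[OF M assms(2) _ short])
  then show ?thesis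
    by (rule grad_eq_zero_of_tendsto[OF M assms(5) _ grad_lim])
qed

end
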